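(* Let $f$ be a generator on $\mathbb{D}$ with $f(0)=0$ and $\operatorname{Re} f'(0)>0$, and let $G_r=(\mathrm{Id}+rf)^{-1}$, $r>0$, be its nonlinear resolvents. The net $\{G_r\}_{r>0}$ converges to zero uniformly on $\mathbb{D}$ as $r\to\infty$.
   Context: $\mathbb{D}=\{z\in\mathbb{C}:|z|<1\}$. A holomorphic function $f:\mathbb{D}\to\mathbb{C}$ is called a generator if for every $z\in\mathbb{D}$ the Cauchy problem $\frac{\partial u(t,z)}{\partial t}+f(u(t,z))=0$, $u(0,z)=z$, has a unique solution $u(t,z)\in\mathbb{D}$ defined for all $t\ge 0$. For a generator $f$ and $r>0$, it is known that $(\mathrm{Id}+rf)(\mathbb{D})\supset\mathbb{D}$ and that $G_r:=(\mathrm{Id}+rf)^{-1}$ is a well-defined holomorphic self-mapping of $\mathbb{D}$ (that is, $G_r(w)$ is the unique $z\in\mathbb{D}$ with $z+rf(z)=w$); it is called the nonlinear resolvent of $f$. *)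

theory Defs
  imports "HOL-Complex_Analysis.Complex_Analysis"
begin

abbreviation unit_disc :: "complex set" where
  "unit_disc \<equiv> ball 0 1"

text \<open>
  Solutions live on the closed half-line, so the derivative at time zero is one-sided;
  values at negative times are irrelevant.
\<close>

definition solves_cauchy_problem ::
    "(complex \<Rightarrow> complex) \<Rightarrow> complex \<Rightarrow> (real \<Rightarrow> complex) \<Rightarrow> bool" where
  "solves_cauchy_problem f z u \<longleftrightarrow>
     u 0 = z \<and>
     (\<forall>t\<ge>0. u t \<in> unit_disc) \<and>
     (\<forall>t\<ge>0. (u has_vector_derivative - f (u t)) (at t within {0..}))"

text \<open>
  Uniqueness is agreement on the half-line, since elements of the HOL type
  \<^typ>\<open>real \<Rightarrow> complex\<close> may still differ at negative times.
\<close>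

definition generator :: "(complex \<Rightarrow> complex) \<Rightarrow> bool" where
  "generator f \<longleftrightarrow>
     f holomorphic_on unit_disc \<and>
     (\<forall>z\<in>unit_disc. \<exists>u. solves_cauchy_problem f z u \<and>
        (\<forall>v. solves_cauchy_problem f z v \<longrightarrow> (\<forall>t\<ge>0. v t = u t)))"

text \<open>
  Meaningful for \<^term>\<open>r > (0::real)\<close>, a generator \<^term>\<open>f\<close> and \<^term>\<open>w \<in> unit_disc\<close>,
  where the described point exists and is unique.
\<close>

definition nonlinear_resolvent ::
    "(complex \<Rightarrow> complex) \<Rightarrow> real \<Rightarrow> complex \<Rightarrow> complex" where
  "nonlinear_resolvent f r w =
     (THE z. z \<in> unit_disc \<and> z + complex_of_real r * f z = w)"

end

theory Submission imports Defs
begin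

text \<open>
  The flow of a generator consists of holomorphic self-maps of the disc that fix the origin, so by
  the Schwarz lemma the flow never increases the modulus.  Differentiating \<open>\<bar>u(t,z)\<bar>\<^sup>2\<close> at
  time zero gives \<open>Re (cnj z * f z) \<ge> 0\<close>, that is, \<open>f z = z * p z\<close> with \<open>Re p \<ge> 0\<close> on the
  disc (\<open>generator_factorization\<close>).

  Put \<open>a = Re f'(0) = Re p(0) > 0\<close>.  The resolvent equation \<open>z + r f(z) = w\<close> reads
  \<open>z (1 + r p(z)) = w\<close>.  Harnack's inequality \<open>Re p(z) \<ge> a (1 - \<bar>z\<bar>) / (1 + \<bar>z\<bar>)\<close> says that
  \<open>p\<close> cannot approach the imaginary axis faster than linearly at the boundary, and the
  room left by \<open>\<bar>w\<bar> < 1\<close> exactly compensates for this: every solution, whatever \<open>w\<close> in the disc, satisfies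
  \<open>\<bar>z\<bar> < 2 / (r a)\<close> (\<open>resolvent_solution_small\<close>).  This is the uniform convergence, at rate
  \<open>1 / r\<close>.

  It remains to know that for large \<open>r\<close> the resolvent value is a solution at all.  A solution
  exists because \<open>z \<mapsto> w / (1 + r p(z))\<close> maps the closed disc of radius \<open>\<bar>w\<bar>\<close> to itself, so that
  Brouwer's theorem applies.  It is unique for large \<open>r\<close>, because then all solutions lie in a
  fixed small disc on which \<open>f\<close> is so close to its linear part that \<open>z + r f(z)\<close> is injective
  for every \<open>r > 0\<close>.

  The holomorphy of the flow in its initial value is derived directly from Gronwall's inequality
  and the linearised equation (\<open>flow_field_differentiable\<close>).
\<close>

section \<open>Dependence of the flow on its initial value\<close>

text \<open>
  Working with the squared norm keeps everything differentiable, also where \<open>h\<close> vanishes: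
  \<open>\<bar>h\<bar>\<^sup>2 exp (-2 L (x - a))\<close> has nonpositive derivative.
\<close>

lemma gronwall_norm_bound:
  fixes h :: "real \<Rightarrow> 'a::real_inner"
  assumes "a \<le> b" and cont: "continuous_on {a..b} h"
    and der: "\<And>x. a < x \<Longrightarrow> x < b \<Longrightarrow> (h has_vector_derivative h' x) (at x)"
    and bound: "\<And>x. a < x \<Longrightarrow> x < b \<Longrightarrow> norm (h' x) \<le> L * norm (h x)"
  shows "norm (h b) \<le> norm (h a) * exp (L * (b - a))"
proof -
  define g where "g x = (h x \<bullet> h x) * exp (- 2 * L * (x - a))" for x
  have "g b \<le> g a"
  proof (rule DERIV_nonpos_imp_decreasing_open[OF \<open>a \<le> b\<close>])
    show "continuous_on {a..b} g"
      unfolding g_def by (intro continuous_intros cont)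
    fix x assume x: "a < x" "x < b"
    have "((\<lambda>x. h x \<bullet> h x) has_real_derivative (h x \<bullet> h' x + h' x \<bullet> h x)) (at x)"
      using bounded_bilinear.has_vector_derivative[OF bounded_bilinear_inner der[OF x] der[OF x]]
      by (simp add: has_real_derivative_iff_has_vector_derivative)
    then have "(g has_real_derivative (h x \<bullet> h' x + h' x \<bullet> h x) * exp (- 2 * L * (x - a))
        + (- 2 * L * exp (- 2 * L * (x - a))) * (h x \<bullet> h x)) (at x)"
      unfolding g_def by (auto intro!: derivative_eq_intros)
    moreover have "h x \<bullet> h' x \<le> L * (h x \<bullet> h x)"
    proof -
      have "h x \<bullet> h' x \<le> norm (h x) * norm (h' x)" by (rule norm_cauchy_schwarz)
      also have "\<dots> \<le> norm (h x) * (L * norm (h x))"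
        by (intro mult_left_mono bound x) simp
      finally show ?thesis by (simp add: dot_square_norm power2_eq_square mult_ac)
    qed
    then have "2 * exp (- 2 * L * (x - a)) * (h x \<bullet> h' x - L * (h x \<bullet> h x)) \<le> 0"
      by (intro mult_nonneg_nonpos) auto
    then have "(h x \<bullet> h' x + h' x \<bullet> h x) * exp (- 2 * L * (x - a))
        + (- 2 * L * exp (- 2 * L * (x - a))) * (h x \<bullet> h x) \<le> 0"
      by (simp add: inner_commute algebra_simps)
    ultimately show "\<exists>y. DERIV g x :> y \<and> y \<le> 0" by blast
  qed
  then have "(norm (h b))\<^sup>2 * exp (- (2 * L * (b - a))) \<le> (norm (h a))\<^sup>2"
    by (simp add: g_def dot_square_norm)
  then have "(norm (h b))\<^sup>2 \<le> (norm (h a))\<^sup>2 * exp (2 * L * (b - a))"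
    unfolding exp_minus by (simp add: divide_inverse[symmetric] pos_divide_le_eq)
  also have "\<dots> = (norm (h a) * exp (L * (b - a)))\<^sup>2"
    by (simp add: power_mult_distrib exp_double[symmetric] mult.assoc)
  finally show ?thesis by (rule power2_le_imp_le) simp
qed

lemma solution_derivative_at:
  assumes "solves_cauchy_problem f z u" "0 < t"
  shows "(u has_vector_derivative - f (u t)) (at t)"
proof -
  have "(u has_vector_derivative - f (u t)) (at t within {0..})"
    using assms by (simp add: solves_cauchy_problem_def)
  then show ?thesis
    using assms by (simp add: at_within_interior[of t "{0..}"])
qed

lemma solution_continuous_on:
  assumes "solves_cauchy_problem f z u"
  shows "continuous_on {0..T} u"
proof (rule continuous_on_vector_derivative)
  fix t assume "t \<in> {0..T}"
  then have "(u has_vector_derivative - f (u t)) (at t within {0..})"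
    using assms by (simp add: solves_cauchy_problem_def)
  then show "(u has_vector_derivative - f (u t)) (at t within {0..T})"
    by (rule has_vector_derivative_within_subset) auto
qed

text \<open>
  A Lipschitz bound for \<open>f\<close> is available only on a closed disc of radius \<open>R < 1\<close>, so Gronwall's
  inequality applies only while \<open>v\<close> remains in the tube of radius \<open>\<delta>\<close> around \<open>u\<close>.  At a first
  exit time it would still give a distance smaller than \<open>\<delta>\<close>, hence there is no exit.
\<close>

lemma solutions_stay_close:
  assumes u: "solves_cauchy_problem f z0 u" and v: "solves_cauchy_problem f z v"
    and lip: "\<And>a b. a \<in> cball 0 R \<Longrightarrow> b \<in> cball 0 R \<Longrightarrow> norm (f a - f b) \<le> L * norm (a - b)"
    and "0 \<le> L"
    and room: "\<And>s. s \<in> {0..T} \<Longrightarrow> norm (u s) + \<delta> \<le> R" and "0 < \<delta>"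
    and near: "norm (z - z0) * exp (L * T) < \<delta>"
    and s: "s \<in> {0..T}"
  shows "norm (v s - u s) < \<delta>" "norm (v s - u s) \<le> norm (z - z0) * exp (L * T)"
proof -
  define h where "h s = v s - u s" for s
  have hcont: "continuous_on {0..t} h" for t
    unfolding h_def by (intro continuous_intros solution_continuous_on[OF u] solution_continuous_on[OF v])
  have gron: "norm (h t) \<le> norm (z - z0) * exp (L * T)"
    if t: "t \<in> {0..T}" and in_tube: "\<And>x. 0 < x \<Longrightarrow> x < t \<Longrightarrow> norm (h x) < \<delta>" for t
  proof -
    have "norm (h t) \<le> norm (h 0) * exp (L * (t - 0))"
    proof (rule gronwall_norm_bound)
      show "0 \<le> t" using t by simp
      show "continuous_on {0..t} h" by (rule hcont)
      fix x assume x: "0 < x" "x < t"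
      show "(h has_vector_derivative (- f (v x)) - (- f (u x))) (at x)"
        unfolding h_def
        by (intro derivative_intros solution_derivative_at[OF u] solution_derivative_at[OF v] x)
      have "norm (u x) + \<delta> \<le> R" using room[of x] x t by simp
      moreover have "norm (v x) \<le> norm (u x) + norm (h x)"
        unfolding h_def by (metis add.commute diff_add_cancel norm_triangle_ineq)
      ultimately have "norm (f (u x) - f (v x)) \<le> L * norm (u x - v x)"
        using in_tube[OF x] \<open>0 < \<delta>\<close> by (intro lip) auto
      then show "norm (- f (v x) - - f (u x)) \<le> L * norm (h x)"
        by (simp add: h_def norm_minus_commute)
    qed
    also have "\<dots> \<le> norm (z - z0) * exp (L * T)"
      using u v t \<open>0 \<le> L\<close>
      by (auto simp: h_def solves_cauchy_problem_def intro!: mult_left_mono)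
    finally show ?thesis .
  qed
  have tube: "norm (h t) < \<delta>" if "t \<in> {0..T}" for t
  proof (rule ccontr)
    \<comment> \<open>The infimum of the exit times is itself an exit time, and the tube is not left before it.\<close>
    define S where "S = {t \<in> {0..T}. \<delta> \<le> norm (h t)}"
    assume "\<not> norm (h t) < \<delta>"
    then have "S \<noteq> {}" using that by (auto simp: S_def)
    moreover have "closed S"
      unfolding S_def by (intro continuous_on_closed_Collect_le continuous_intros hcont closed_atLeastAtMost)
    moreover have bdd: "bdd_below S" by (auto simp: S_def bdd_below_def)
    ultimately have "Inf S \<in> S" by (simp add: closed_contains_Inf)
    moreover have "norm (h x) < \<delta>" if "0 < x" "x < Inf S" for x
    proof (rule ccontr)
      assume "\<not> norm (h x) < \<delta>"
      then have "x \<in> S" using that \<open>Inf S \<in> S\<close> by (auto simp: S_def)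
      then show False using cInf_lower[OF _ bdd, of x] that by simp
    qed
    ultimately show False
      using gron[of "Inf S"] near by (auto simp: S_def)
  qed
  show "norm (v s - u s) < \<delta>" using tube[OF s] by (simp add: h_def)
  show "norm (v s - u s) \<le> norm (z - z0) * exp (L * T)"
    using gron[OF s] tube s by (auto simp: h_def)
qed


text \<open>
  The difference \<open>h\<close> of two solutions satisfies \<open>h' = - f'(u) h + O(\<bar>h\<bar>\<^sup>2)\<close>, where \<open>h\<close> is of
  the order of \<open>\<bar>z - z0\<bar>\<close>.  Multiplication by the integrating factor \<open>E = exp (\<integral> f'(u))\<close> of the
  linearised equation removes the linear term.  Hence \<open>h(T) E(T) = (z - z0) + O(\<bar>z - z0\<bar>\<^sup>2)\<close>, and
  the derivative is \<open>1 / E(T)\<close>.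
\<close>

lemma flow_field_differentiable:
  assumes hol: "f holomorphic_on unit_disc"
    and sol: "\<And>z. z \<in> unit_disc \<Longrightarrow> solves_cauchy_problem f z (U z)"
    and "0 \<le> T" and z0: "z0 \<in> unit_disc"
  shows "(\<lambda>z. U z T) field_differentiable at z0"
proof -
  define u where "u = U z0"
  have u: "solves_cauchy_problem f z0 u" using sol z0 by (simp add: u_def)
  have ucont: "continuous_on {0..T} u" by (rule solution_continuous_on[OF u])
  have "compact ((\<lambda>s. norm (u s)) ` {0..T})"
    by (intro compact_continuous_image continuous_intros ucont) simp
  then obtain s1 where "s1 \<in> {0..T}" and s1: "\<And>s. s \<in> {0..T} \<Longrightarrow> norm (u s) \<le> norm (u s1)"
    using \<open>0 \<le> T\<close> compact_attains_sup[of "(\<lambda>s. norm (u s)) ` {0..T}"] by auto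
  define \<delta> where "\<delta> = (1 - norm (u s1)) / 2"
  define R where "R = norm (u s1) + \<delta>"
  have "norm (u s1) < 1" using u \<open>s1 \<in> {0..T}\<close> by (auto simp: solves_cauchy_problem_def)
  then have "0 < \<delta>" "R < 1" by (auto simp: \<delta>_def R_def field_simps)
  have room: "norm (u s) + \<delta> \<le> R" if "s \<in> {0..T}" for s
    using s1[OF that] by (simp add: R_def)
  have sub: "cball 0 R \<subseteq> unit_disc" using \<open>R < 1\<close> by auto
  have df: "(f has_field_derivative deriv f a) (at a)" if "a \<in> unit_disc" for a
    using hol that by (simp add: holomorphic_derivI)
  have hol': "deriv f holomorphic_on unit_disc" by (intro holomorphic_deriv hol) simp
  have ddf: "(deriv f has_field_derivative deriv (deriv f) a) (at a)" if "a \<in> unit_disc" for a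
    using hol' that by (simp add: holomorphic_derivI)
  have bdd: "\<exists>B\<ge>0. \<forall>a\<in>cball 0 R. norm (g a) \<le> B" if "g holomorphic_on unit_disc" for g :: "complex \<Rightarrow> complex"
  proof -
    have "bounded (g ` cball 0 R)"
      using holomorphic_on_imp_continuous_on[OF holomorphic_on_subset[OF that sub]]
      by (intro compact_imp_bounded compact_continuous_image) auto
    then show ?thesis by (auto simp: bounded_pos intro: less_imp_le)
  qed
  \<comment> \<open>First and second order control of \<open>f\<close> on a disc that contains the tube around \<open>u\<close>.\<close>
  obtain L where "0 \<le> L" and L: "\<And>a. a \<in> cball 0 R \<Longrightarrow> norm (deriv f a) \<le> L"
    using bdd[OF hol'] by auto
  obtain C where "0 \<le> C" and C: "\<And>a. a \<in> cball 0 R \<Longrightarrow> norm (deriv (deriv f) a) \<le> C"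
    using bdd[OF holomorphic_deriv[OF hol']] by auto
  have lip: "norm (f a - f b) \<le> L * norm (a - b)" if "a \<in> cball 0 R" "b \<in> cball 0 R" for a b
    using that sub
    by (intro field_differentiable_bound[where S = "cball 0 R" and f' = "deriv f"] L
        has_field_derivative_at_within[OF df]) auto
  have taylor: "norm (f b - f a - deriv f a * (b - a)) \<le> C * (norm (b - a))\<^sup>2"
    if "a \<in> cball 0 R" "b \<in> cball 0 R" for a b
  proof -
    have "norm ((\<lambda>i. (deriv ^^ i) f) 0 b - (\<Sum>i\<le>1. (\<lambda>i. (deriv ^^ i) f) i a * (b - a) ^ i / fact i))
        \<le> C * norm (b - a) ^ Suc 1 / fact 1"
    proof (rule complex_Taylor[where S = "cball 0 R"])
      fix i :: nat and x :: complex assume "x \<in> cball 0 R" "i \<le> 1"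
      then show "((deriv ^^ i) f has_field_derivative (deriv ^^ Suc i) f x) (at x within cball 0 R)"
        using sub by (cases i) (auto intro!: has_field_derivative_at_within df ddf)
    qed (use that C in auto)
    then show ?thesis by (simp add: power2_eq_square algebra_simps)
  qed

  define A where "A s = integral {0..s} (\<lambda>x. deriv f (u x))" for s
  define E where "E s = exp (A s)" for s
  have dfu: "continuous_on {0..T} (\<lambda>x. deriv f (u x))"
    using u by (intro continuous_on_compose2[OF holomorphic_on_imp_continuous_on[OF hol'] ucont])
      (auto simp: solves_cauchy_problem_def)
  have dA: "(A has_vector_derivative deriv f (u s)) (at s within {0..T})" if "s \<in> {0..T}" for s
    unfolding A_def by (rule integral_has_vector_derivative[OF dfu that])
  have dE: "(E has_vector_derivative deriv f (u s) * E s) (at s within {0..T})" if "s \<in> {0..T}" for s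
    using field_vector_diff_chain_within[OF dA[OF that] has_field_derivative_at_within[OF DERIV_exp]]
    by (simp add: E_def[abs_def] o_def)
  have Econt: "continuous_on {0..T} E"
    by (rule continuous_on_vector_derivative[OF dE])
  then have "bounded (E ` {0..T})"
    by (intro compact_imp_bounded compact_continuous_image) auto
  then obtain M where "0 \<le> M" and M: "\<And>s. s \<in> {0..T} \<Longrightarrow> norm (E s) \<le> M"
    unfolding bounded_pos by (meson imageI less_imp_le)
  have E0: "E 0 = 1" and ET: "E T \<noteq> 0" by (auto simp: E_def A_def)
  define K where "K = exp (L * T)"
  define D where "D = T * (C * K\<^sup>2 * M)"

  \<comment> \<open>First-order expansion of the flow at \<open>z0\<close>, with an explicit quadratic error.\<close>
  have quad: "norm ((U z T - U z0 T) * E T - (z - z0)) \<le> D * (norm (z - z0))\<^sup>2"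
    if z: "z \<in> unit_disc" and near: "norm (z - z0) * K < \<delta>" for z
  proof -
    define h where "h s = U z s - u s" for s
    define hE' where "hE' s = h s * (deriv f (u s) * E s) + (f (u s) - f (U z s)) * E s" for s
    have v: "solves_cauchy_problem f z (U z)" using sol z by simp
    have close: "norm (h s) < \<delta>" "norm (h s) \<le> norm (z - z0) * K" if "s \<in> {0..T}" for s
      using solutions_stay_close[OF u v lip \<open>0 \<le> L\<close> room \<open>0 < \<delta>\<close> near[unfolded K_def] that]
      by (auto simp: h_def K_def)
    have in_ball: "u s \<in> cball 0 R" "U z s \<in> cball 0 R" if "s \<in> {0..T}" for s
    proof -
      have "norm (U z s) \<le> norm (u s) + norm (h s)"
        unfolding h_def by (metis add.commute diff_add_cancel norm_triangle_ineq)
      then show "u s \<in> cball 0 R" "U z s \<in> cball 0 R"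
        using room[OF that] close(1)[OF that] \<open>0 < \<delta>\<close> by auto
    qed
    have rate: "norm (hE' s) \<le> C * (norm (z - z0) * K)\<^sup>2 * M" if s: "s \<in> {0..T}" for s
    proof -
      have "hE' s = - (f (U z s) - f (u s) - deriv f (u s) * (U z s - u s)) * E s"
        by (simp add: hE'_def h_def algebra_simps)
      then have "norm (hE' s) = norm (f (U z s) - f (u s) - deriv f (u s) * (U z s - u s)) * norm (E s)"
        by (simp only: norm_mult norm_minus_cancel)
      also have "\<dots> \<le> (C * (norm (h s))\<^sup>2) * M"
        using taylor[OF in_ball[OF s]] M[OF s] \<open>0 \<le> C\<close> by (intro mult_mono) (auto simp: h_def)
      also have "\<dots> \<le> C * (norm (z - z0) * K)\<^sup>2 * M"
        using \<open>0 \<le> C\<close> \<open>0 \<le> M\<close> close(2)[OF s] by (intro mult_right_mono mult_left_mono power_mono) auto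
      finally show ?thesis .
    qed
    have "((\<lambda>s. h s * E s) has_vector_derivative hE' s) (at s within {0..T})"
      if s: "s \<in> {0..T}" for s
    proof -
      have "(w has_vector_derivative - f (w s)) (at s within {0..T})"
        if "solves_cauchy_problem f y w" for y w
        using that s unfolding solves_cauchy_problem_def
        by (auto intro: has_vector_derivative_within_subset[of w _ s "{0..}"])
      from has_vector_derivative_diff[OF this[OF v] this[OF u]]
      have "(h has_vector_derivative f (u s) - f (U z s)) (at s within {0..T})"
        by (simp add: h_def[abs_def])
      from has_vector_derivative_mult[OF this dE[OF s]] show ?thesis
        by (simp add: hE'_def)
    qed
    moreover have "onorm (\<lambda>x. x *\<^sub>R hE' s) \<le> C * (norm (z - z0) * K)\<^sup>2 * M" if s: "s \<in> {0..T}" for s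
    proof (rule onorm_le)
      fix x :: real
      show "norm (x *\<^sub>R hE' s) \<le> C * (norm (z - z0) * K)\<^sup>2 * M * norm x"
        using mult_left_mono[OF rate[OF s] abs_ge_zero[of x]] by (simp add: mult.commute)
    qed
    ultimately have "norm (h T * E T - h 0 * E 0) \<le> (C * (norm (z - z0) * K)\<^sup>2 * M) * norm (T - 0)"
      using \<open>0 \<le> T\<close>
      by (intro differentiable_bound[of "{0..T}" "\<lambda>s. h s * E s" "\<lambda>s x. x *\<^sub>R hE' s"])
        (auto simp: has_vector_derivative_def)
    moreover have "h 0 = z - z0" using u v by (simp add: h_def solves_cauchy_problem_def)
    ultimately show ?thesis
      using \<open>0 \<le> T\<close> by (simp add: E0 D_def h_def u_def power_mult_distrib mult_ac)
  qed
  have "((\<lambda>z. (U z T - U z0 T) / (z - z0) - 1 / E T) \<longlongrightarrow> 0) (at z0)"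
  proof (rule Lim_null_comparison)
    have "((\<lambda>z. norm (z - z0) * K) \<longlongrightarrow> norm (z0 - z0) * K) (at z0)"
      by (intro tendsto_intros)
    then have "\<forall>\<^sub>F z in at z0. norm (z - z0) * K < \<delta>"
      using \<open>0 < \<delta>\<close> by (intro order_tendstoD(2)) auto
    moreover have "\<forall>\<^sub>F z in at z0. z \<in> unit_disc - {z0}"
      using z0 by (intro eventually_at_in_open) auto
    ultimately show "\<forall>\<^sub>F z in at z0. norm ((U z T - U z0 T) / (z - z0) - 1 / E T)
        \<le> (D / norm (E T)) * norm (z - z0)"
    proof eventually_elim
      case (elim z)
      have "(U z T - U z0 T) / (z - z0) - 1 / E T
          = ((U z T - U z0 T) * E T - (z - z0)) / ((z - z0) * E T)"
        using elim ET by (simp add: field_simps)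
      then have "norm ((U z T - U z0 T) / (z - z0) - 1 / E T)
          = norm ((U z T - U z0 T) * E T - (z - z0)) / (norm (z - z0) * norm (E T))"
        by (simp only: norm_divide norm_mult)
      also have "\<dots> \<le> D * (norm (z - z0))\<^sup>2 / (norm (z - z0) * norm (E T))"
        using quad[of z] elim by (intro divide_right_mono) auto
      also have "\<dots> = (D / norm (E T)) * norm (z - z0)"
        using elim by (simp add: power2_eq_square)
      finally show ?case .
    qed
    show "((\<lambda>z. (D / norm (E T)) * norm (z - z0)) \<longlongrightarrow> 0) (at z0)"
      using ET by (auto intro!: tendsto_eq_intros)
  qed
  then have "((\<lambda>z. U z T) has_field_derivative 1 / E T) (at z0)"
    by (simp add: has_field_derivative_iff LIM_zero_iff)
  then show ?thesis by (auto simp: field_differentiable_def)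
qed


section \<open>Positivity of the real part of f(z)/z\<close>

lemma flow_map_norm_le:
  assumes hol: "f holomorphic_on unit_disc"
    and sol: "\<And>z. z \<in> unit_disc \<Longrightarrow> solves_cauchy_problem f z (U z)"
    and fixed: "U 0 t = 0" and "0 \<le> t" and z: "z \<in> unit_disc"
  shows "norm (U z t) \<le> norm z"
proof (rule Schwarz_Lemma(1))
  show "(\<lambda>z. U z t) holomorphic_on unit_disc"
    using flow_field_differentiable[OF hol sol \<open>0 \<le> t\<close>]
    by (auto simp: holomorphic_on_def intro: field_differentiable_at_within)
  show "norm (U z t) < 1" if "norm z < 1" for z
    using sol[of z] that \<open>0 \<le> t\<close> by (simp add: solves_cauchy_problem_def)
qed (use fixed z in auto)

text \<open>
  The squared modulus of a trajectory has one-sided derivative \<open>-2 Re (cnj z * f z)\<close> at time zero;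
  were it positive, the modulus would grow, against the Schwarz lemma for the flow.
\<close>

lemma generator_Re_cnj_mult_nonneg:
  assumes gen: "generator f" and "f 0 = 0" and z: "z \<in> unit_disc"
  shows "0 \<le> Re (cnj z * f z)"
proof (rule ccontr)
  assume neg: "\<not> 0 \<le> Re (cnj z * f z)"
  have hol: "f holomorphic_on unit_disc" using gen by (simp add: generator_def)
  from gen have "\<forall>z\<in>unit_disc. \<exists>u. solves_cauchy_problem f z u \<and>
      (\<forall>v. solves_cauchy_problem f z v \<longrightarrow> (\<forall>t\<ge>0. v t = u t))"
    by (simp add: generator_def)
  then obtain U where sol: "\<And>z. z \<in> unit_disc \<Longrightarrow> solves_cauchy_problem f z (U z)"
    and unique: "\<And>z v t. z \<in> unit_disc \<Longrightarrow> solves_cauchy_problem f z v \<Longrightarrow> 0 \<le> t \<Longrightarrow> v t = U z t"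
    by metis
  have "solves_cauchy_problem f 0 (\<lambda>t. 0)"
    using \<open>f 0 = 0\<close> by (simp add: solves_cauchy_problem_def)
  then have fixed: "U 0 t = 0" if "0 \<le> t" for t
    using unique[of 0 "\<lambda>t. 0" t] that by simp
  define g where "g t = U z t \<bullet> U z t" for t
  have U0: "U z 0 = z" using sol[OF z] by (simp add: solves_cauchy_problem_def)
  have "(U z has_vector_derivative - f (U z 0)) (at 0 within {0..})"
    using sol[OF z] unfolding solves_cauchy_problem_def by blast
  from bounded_bilinear.has_vector_derivative[OF bounded_bilinear_inner this this]
  have "(g has_real_derivative - 2 * Re (cnj z * f z)) (at 0 within {0..})"
    by (simp add: g_def[abs_def] U0 has_real_derivative_iff_has_vector_derivative
        inner_complex_def algebra_simps)
  from has_real_derivative_pos_inc_right[OF this] neg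
  obtain d where "0 < d" and inc: "\<And>h. 0 < h \<Longrightarrow> h < d \<Longrightarrow> g 0 < g h"
    by auto
  have "g 0 < g (d / 2)" using inc \<open>0 < d\<close> by simp
  moreover have "norm (U z (d / 2)) \<le> norm z"
    using flow_map_norm_le[OF hol sol fixed _ z] \<open>0 < d\<close> by simp
  then have "g (d / 2) \<le> g 0"
    by (simp add: g_def U0 dot_square_norm power_mono)
  ultimately show False by simp
qed


lemma generator_factorization:
  assumes gen: "generator f" and "f 0 = 0" and pos: "0 \<le> Re (deriv f 0)"
  obtains p where "p holomorphic_on unit_disc" "p 0 = deriv f 0" "\<And>z. f z = z * p z"
    "\<And>z. z \<in> unit_disc \<Longrightarrow> 0 \<le> Re (p z)"
proof -
  define p where "p z = (if z = 0 then deriv f 0 else (f z - f 0) / (z - 0))" for z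
  have fp: "f z = z * p z" for z using \<open>f 0 = 0\<close> by (simp add: p_def)
  show thesis
  proof (rule that)
    show "p holomorphic_on unit_disc"
      using pole_lemma[of f unit_disc 0] gen unfolding p_def[abs_def] generator_def by auto
    show "p 0 = deriv f 0" by (simp add: p_def)
    show "f z = z * p z" for z by (rule fp)
    fix z assume z: "z \<in> unit_disc"
    show "0 \<le> Re (p z)"
    proof (cases "z = 0")
      case True
      then show ?thesis using pos by (simp add: p_def)
    next
      case False
      have "cnj z * f z = of_real ((norm z)\<^sup>2) * p z"
        using fp[of z] complex_norm_square[of z] by (simp add: mult_ac)
      then have "Re (cnj z * f z) = (norm z)\<^sup>2 * Re (p z)"
        by simp
      then show ?thesis
        using generator_Re_cnj_mult_nonneg[OF gen \<open>f 0 = 0\<close> z] False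
        by (simp add: zero_le_mult_iff)
    qed
  qed
qed

section \<open>Solutions of the resolvent equation\<close>

text \<open>
  Harnack's inequality for nonnegative real parts, written without division.  The Cayley transform
  \<open>(q - c) / (q + cnj c)\<close> with \<open>c = q(0)\<close> maps the right half-plane to the disc and sends
  \<open>q(0)\<close> to zero, so the Schwarz lemma bounds it by \<open>\<bar>z\<bar>\<close>.  Adding a small \<open>e > 0\<close> to \<open>q\<close> puts
  its values into the open half-plane, which the strict bound in the Schwarz lemma requires.
\<close>

lemma Harnack_lower_bound_on_disc:
  assumes hol: "q holomorphic_on unit_disc"
    and nonneg: "\<And>z. z \<in> unit_disc \<Longrightarrow> 0 \<le> Re (q z)"
    and z: "z \<in> unit_disc"
  shows "Re (q 0) * (1 - norm z) \<le> Re (q z) * (1 + norm z)"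
proof -
  have shifted: "(Re (q 0) + e) * (1 - norm z) \<le> (Re (q z) + e) * (1 + norm z)" if "0 < e" for e
  proof -
    define c where "c = q 0 + of_real e"
    define \<phi> where "\<phi> w = (q w + of_real e - c) / (q w + of_real e + cnj c)" for w
    have "0 < Re c" using nonneg[of 0] that by (simp add: c_def)
    have pos: "0 < Re (q w + of_real e)" if "w \<in> unit_disc" for w
      using nonneg[OF that] \<open>0 < e\<close> by simp
    have nz: "q w + of_real e + cnj c \<noteq> 0" if "w \<in> unit_disc" for w
    proof -
      have "0 < Re (q w + of_real e + cnj c)" using pos[OF that] \<open>0 < Re c\<close> by simp
      then show ?thesis by (metis less_irrefl zero_complex.sel(1))
    qed
    have "norm (\<phi> z) \<le> norm z"
    proof (rule Schwarz_Lemma(1))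
      show "\<phi> holomorphic_on unit_disc"
        unfolding \<phi>_def using nz by (intro holomorphic_intros hol) auto
      show "\<phi> 0 = 0" by (simp add: \<phi>_def c_def)
      show "norm z < 1" using z by simp
      fix w :: complex assume "norm w < 1"
      then have w: "w \<in> unit_disc" by simp
      have "0 < Re (q w + of_real e) * Re c" using pos[OF w] \<open>0 < Re c\<close> by simp
      then have "(norm (q w + of_real e - c))\<^sup>2 < (norm (q w + of_real e + cnj c))\<^sup>2"
        unfolding cmod_power2 by (simp add: power2_eq_square algebra_simps)
      then have "norm (q w + of_real e - c) < norm (q w + of_real e + cnj c)"
        by (rule power2_less_imp_less) simp
      then show "norm (\<phi> w) < 1"
        using nz[OF w] by (simp add: \<phi>_def norm_divide)
    qed
    \<comment> \<open>In coordinates, the imaginary part only weakens the bound and can be dropped.\<close>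
    define x where "x = norm z"
    define X where "X = Re (q z) + e"
    define Y where "Y = Im (q z) - Im c"
    have x: "0 \<le> x" "x < 1" using z by (auto simp: x_def)
    have "0 < X" using pos[OF z] by (simp add: X_def)
    have "norm (q z + of_real e - c) \<le> x * norm (q z + of_real e + cnj c)"
      using \<open>norm (\<phi> z) \<le> norm z\<close> nz[OF z] by (simp add: \<phi>_def norm_divide x_def divide_simps)
    then have "(norm (q z + of_real e - c))\<^sup>2 \<le> (x * norm (q z + of_real e + cnj c))\<^sup>2"
      by (intro power_mono) auto
    then have "(X - Re c)\<^sup>2 + Y\<^sup>2 \<le> x\<^sup>2 * ((X + Re c)\<^sup>2 + Y\<^sup>2)"
      by (simp add: power_mult_distrib cmod_power2 X_def Y_def)
    moreover have "x\<^sup>2 * Y\<^sup>2 \<le> 1 * Y\<^sup>2"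
      using x by (intro mult_right_mono) (auto simp: power_le_one)
    ultimately have "(Re c - X)\<^sup>2 \<le> (x * (X + Re c))\<^sup>2"
      unfolding power_mult_distrib power2_commute[of "Re c" X] by (simp add: distrib_left)
    then have "Re c - X \<le> x * (X + Re c)"
      by (rule power2_le_imp_le) (use x \<open>0 < X\<close> \<open>0 < Re c\<close> in auto)
    then show ?thesis by (simp add: X_def x_def c_def algebra_simps)
  qed
  show ?thesis
  proof (rule field_le_epsilon)
    fix e :: real assume "0 < e"
    have "norm z < 1" using z by simp
    have "Re (q 0) * (1 - norm z) \<le> (Re (q 0) + e / 2) * (1 - norm z)"
      using \<open>0 < e\<close> z by (intro mult_right_mono) auto
    also have "\<dots> \<le> (Re (q z) + e / 2) * (1 + norm z)"
      using shifted[of "e / 2"] \<open>0 < e\<close> by simp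
    also have "\<dots> = Re (q z) * (1 + norm z) + e * ((1 + norm z) / 2)"
      by (simp add: field_simps)
    also have "\<dots> \<le> Re (q z) * (1 + norm z) + e * 1"
      using \<open>0 < e\<close> \<open>norm z < 1\<close> by (intro add_left_mono mult_left_mono) auto
    finally show "Re (q 0) * (1 - norm z) \<le> Re (q z) * (1 + norm z) + e" by simp
  qed
qed

text \<open>
  With \<open>x = \<bar>z\<bar>\<close>, the equation gives \<open>x (1 + r Re p) < 1\<close>, so \<open>r x Re p < 1 - x\<close>, while the
  Harnack bound gives \<open>r x Re p \<ge> r x a (1 - x) / (1 + x)\<close>.  The factor \<open>1 - x\<close> cancels, which
  is why no solution can hide near the boundary.
\<close>

lemma resolvent_solution_small:
  assumes harnack: "a * (1 - norm z) \<le> Re p * (1 + norm z)"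
    and "z \<in> unit_disc" "0 < r" "0 < a" "w \<in> unit_disc"
    and eq: "z * (1 + of_real r * p) = w"
  shows "norm z < 2 / (r * a)"
proof -
  define x where "x = norm z"
  have x: "0 \<le> x" "x < 1" using assms by (auto simp: x_def)
  have "x * (1 + r * Re p) \<le> x * norm (1 + of_real r * p)"
    using x complex_Re_le_cmod[of "1 + of_real r * p"] by (intro mult_left_mono) auto
  also have "\<dots> = norm w" by (simp add: eq[symmetric] norm_mult x_def)
  also have "\<dots> < 1" using assms by simp
  finally have "r * x * Re p < 1 - x" by (simp add: algebra_simps)
  then have "r * x * Re p * (1 + x) < (1 - x) * (1 + x)"
    using x by (intro mult_strict_right_mono) auto
  moreover have "r * x * (a * (1 - x)) \<le> r * x * (Re p * (1 + x))"
    using harnack \<open>0 < r\<close> x by (intro mult_left_mono) (auto simp: x_def)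
  ultimately have "(r * x * a) * (1 - x) < (1 + x) * (1 - x)" by (simp add: algebra_simps)
  then have "r * x * a < 1 + x" using x by (simp add: mult_less_cancel_right)
  also have "\<dots> < 2" using x by simp
  finally show ?thesis using \<open>0 < r\<close> \<open>0 < a\<close> by (simp add: x_def field_simps)
qed

text \<open>
  The denominator \<open>1 + r p(z)\<close> has modulus at least one, so \<open>z \<mapsto> w / (1 + r p(z))\<close> maps the disc
  into the closed disc of radius \<open>\<bar>w\<bar>\<close>; the solutions are its fixed points.
\<close>

lemma resolvent_solution_exists:
  fixes p :: "complex \<Rightarrow> complex"
  assumes cont: "continuous_on unit_disc p"
    and nonneg: "\<And>z. z \<in> unit_disc \<Longrightarrow> 0 \<le> Re (p z)"
    and "0 < r" and w: "w \<in> unit_disc"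
  obtains z where "z \<in> unit_disc" "z * (1 + of_real r * p z) = w"
proof -
  have sub: "cball 0 (norm w) \<subseteq> unit_disc" using w by auto
  have ge1: "1 \<le> norm (1 + of_real r * p z)" if "z \<in> unit_disc" for z
  proof -
    have "1 \<le> Re (1 + of_real r * p z)" using nonneg[OF that] \<open>0 < r\<close> by simp
    then show ?thesis using complex_Re_le_cmod order_trans by blast
  qed
  have nz: "1 + of_real r * p z \<noteq> 0" if "z \<in> unit_disc" for z
    using ge1[OF that] by auto
  obtain z where z: "z \<in> cball 0 (norm w)" "w / (1 + of_real r * p z) = z"
  proof (rule brouwer[of "cball 0 (norm w)" "\<lambda>z. w / (1 + of_real r * p z)"])
    show "continuous_on (cball 0 (norm w)) (\<lambda>z. w / (1 + of_real r * p z))"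
      using nz sub by (intro continuous_intros continuous_on_subset[OF cont]) auto
    show "(\<lambda>z. w / (1 + of_real r * p z)) \<in> cball 0 (norm w) \<rightarrow> cball 0 (norm w)"
    proof
      fix z :: complex assume "z \<in> cball 0 (norm w)"
      then have "1 \<le> norm (1 + of_real r * p z)" using ge1 sub by blast
      then have "norm w / norm (1 + of_real r * p z) \<le> norm w / 1"
        by (intro divide_left_mono) auto
      then show "w / (1 + of_real r * p z) \<in> cball 0 (norm w)"
        by (simp add: norm_divide)
    qed
  qed auto
  show thesis
  proof (rule that)
    show "z \<in> unit_disc" using z sub by blast
    then show "z * (1 + of_real r * p z) = w"
      using nz z(2) by (metis nonzero_eq_divide_eq)
  qed
qed

text \<open>
  The radius \<open>\<delta>\<close> has to serve all \<open>r > 0\<close> at once.  With \<open>c = f'(0)\<close>, take it so small that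
  \<open>f(z) - c z\<close> is Lipschitz with constant \<open>Re c\<close> on the disc of radius \<open>\<delta>\<close>.  For two
  solutions the equation gives
  \<open>\<bar>1 + r c\<bar> \<bar>z1 - z2\<bar> \<le> r Re c \<bar>z1 - z2\<bar>\<close>, whereas \<open>\<bar>1 + r c\<bar> \<ge> 1 + r Re c\<close>.
\<close>

lemma resolvent_equation_injective_near_zero:
  assumes hol: "f holomorphic_on unit_disc" and pos: "0 < Re (deriv f 0)"
  obtains \<delta> where "0 < \<delta>"
    "\<And>r z1 z2. \<lbrakk>0 < r; z1 \<in> ball 0 \<delta>; z2 \<in> ball 0 \<delta>;
       z1 + of_real r * f z1 = z2 + of_real r * f z2\<rbrakk> \<Longrightarrow> z1 = z2"
proof -
  define c where "c = deriv f 0"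
  have "continuous_on unit_disc (deriv f)"
    by (intro holomorphic_on_imp_continuous_on holomorphic_deriv hol) simp
  then have "isCont (deriv f) 0" by (simp add: continuous_on_eq_continuous_at)
  then obtain d where "0 < d" and d: "\<And>z. dist z 0 < d \<Longrightarrow> dist (deriv f z) c < Re c"
    using pos by (auto simp: continuous_at_eps_delta c_def)
  define \<delta> where "\<delta> = min d 1"
  have lin: "norm ((f z1 - c * z1) - (f z2 - c * z2)) \<le> Re c * norm (z1 - z2)"
    if "z1 \<in> ball 0 \<delta>" "z2 \<in> ball 0 \<delta>" for z1 z2
  proof (rule field_differentiable_bound[where S = "ball 0 \<delta>" and f' = "\<lambda>z. deriv f z - c"])
    fix z assume z: "z \<in> ball (0::complex) \<delta>"
    then have "(f has_field_derivative deriv f z) (at z)"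
      using hol by (intro holomorphic_derivI[of f unit_disc]) (auto simp: \<delta>_def)
    then have "((\<lambda>z. f z - c * z) has_field_derivative deriv f z - c) (at z)"
      by (auto intro!: derivative_eq_intros)
    then show "((\<lambda>z. f z - c * z) has_field_derivative deriv f z - c) (at z within ball 0 \<delta>)"
      by (rule has_field_derivative_at_within)
    show "norm (deriv f z - c) \<le> Re c"
      using d[of z] z by (auto simp: \<delta>_def dist_norm)
  qed (use that in auto)
  show thesis
  proof (rule that)
    show "0 < \<delta>" using \<open>0 < d\<close> by (auto simp: \<delta>_def)
    fix r z1 z2 assume "0 < r" and z12: "z1 \<in> ball 0 \<delta>" "z2 \<in> ball 0 \<delta>"
      and eq: "z1 + of_real r * f z1 = z2 + of_real r * f z2"
    define e where "e = (f z1 - c * z1) - (f z2 - c * z2)"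
    have "(1 + of_real r * c) * (z1 - z2) = - of_real r * e"
      using eq by (simp add: e_def algebra_simps)
    then have "norm ((1 + of_real r * c) * (z1 - z2)) = norm (- of_real r * e)"
      by (rule arg_cong)
    then have "norm (1 + of_real r * c) * norm (z1 - z2) = r * norm e"
      using \<open>0 < r\<close> by (simp add: norm_mult)
    also have "\<dots> \<le> r * (Re c * norm (z1 - z2))"
      using lin[OF z12] \<open>0 < r\<close> by (simp add: e_def)
    finally have "norm (1 + of_real r * c) * norm (z1 - z2) \<le> (r * Re c) * norm (z1 - z2)"
      by (simp add: mult_ac)
    moreover have "r * Re c < norm (1 + of_real r * c)"
      using complex_Re_le_cmod[of "1 + of_real r * c"] by simp
    ultimately show "z1 = z2"
      by (auto simp: mult_le_cancel_right)
  qed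
qed

section \<open>Convergence of the resolvents\<close>

theorem corollary3p1:
  fixes f :: "complex \<Rightarrow> complex"
  assumes "generator f"
    and "f 0 = 0"
    and "Re (deriv f 0) > 0"
  shows "uniform_limit unit_disc (\<lambda>r. nonlinear_resolvent f r) (\<lambda>w. 0) at_top"
proof -
  define a where "a = Re (deriv f 0)"
  have "0 < a" using assms by (simp add: a_def)
  obtain p where hol: "p holomorphic_on unit_disc" and p0: "p 0 = deriv f 0"
    and fp: "\<And>z. f z = z * p z" and nonneg: "\<And>z. z \<in> unit_disc \<Longrightarrow> 0 \<le> Re (p z)"
    using generator_factorization[OF assms(1,2)] assms(3) by (metis less_imp_le)
  have split: "z + of_real r * f z = z * (1 + of_real r * p z)" for z :: complex and r
    by (simp add: fp algebra_simps)
  have small: "norm z < 2 / (r * a)"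
    if "0 < r" "z \<in> unit_disc" "w \<in> unit_disc" "z + of_real r * f z = w" for r z w
    using that Harnack_lower_bound_on_disc[OF hol nonneg, of z] \<open>0 < a\<close>
    by (intro resolvent_solution_small[of a z "p z" r w]) (auto simp: p0 a_def split)
  obtain \<delta> where "0 < \<delta>"
    and inj: "\<And>r z1 z2. \<lbrakk>0 < r; z1 \<in> ball 0 \<delta>; z2 \<in> ball 0 \<delta>;
       z1 + of_real r * f z1 = z2 + of_real r * f z2\<rbrakk> \<Longrightarrow> z1 = z2"
    using resolvent_equation_injective_near_zero[OF _ assms(3)] assms(1)
    unfolding generator_def by metis
  \<comment> \<open>Once \<open>2 / (r a) < \<delta>\<close>, all solutions lie where the equation is injective, so the definite
     description in the resolvent denotes the solution.\<close>
  have bound: "norm (nonlinear_resolvent f r w) < 2 / (r * a)"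
    if r: "0 < r" "2 / (r * a) < \<delta>" and w: "w \<in> unit_disc" for r w
  proof -
    obtain z where z: "z \<in> unit_disc" "z + of_real r * f z = w"
      using resolvent_solution_exists[OF holomorphic_on_imp_continuous_on[OF hol] nonneg r(1) w] split
      by metis
    have "nonlinear_resolvent f r w = z"
      unfolding nonlinear_resolvent_def
    proof (rule the_equality)
      fix y assume y: "y \<in> unit_disc \<and> y + of_real r * f y = w"
      then have "y \<in> ball 0 \<delta>" "z \<in> ball 0 \<delta>"
        using small[OF r(1) _ w, of y] small[OF r(1) z(1) w z(2)] r(2) by auto
      then show "y = z" using inj[OF r(1)] y z by simp
    qed (use z in simp)
    then show ?thesis using small[OF r(1) z(1) w z(2)] by simp
  qed
  have vanish: "((\<lambda>r. 2 / (r * a)) \<longlongrightarrow> 0) at_top"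
  proof -
    have "filterlim (\<lambda>r. r * a) at_top at_top"
      using \<open>0 < a\<close> by (intro filterlim_at_top_mult_tendsto_pos[OF tendsto_const]) (auto intro: filterlim_ident)
    then show ?thesis
      by (rule tendsto_divide_0[OF tendsto_const filterlim_at_top_imp_at_infinity])
  qed
  show ?thesis
    unfolding uniform_limit_iff
  proof (intro allI impI)
    fix e :: real assume "0 < e"
    have "\<forall>\<^sub>F r in at_top. 2 / (r * a) < \<delta>" "\<forall>\<^sub>F r in at_top. 2 / (r * a) < e"
      using order_tendstoD(2)[OF vanish] \<open>0 < \<delta>\<close> \<open>0 < e\<close> by auto
    with eventually_gt_at_top[of 0]
    show "\<forall>\<^sub>F r in at_top. \<forall>w\<in>unit_disc. dist (nonlinear_resolvent f r w) 0 < e"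
      by eventually_elim (use bound in \<open>fastforce simp: dist_norm\<close>)
  qed
qed

end
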